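(* Consider the caching problem with machine learned predictions. Let $A$ be an $\alpha$-robust caching algorithm and let $B$ be a $\gamma$-competitive caching algorithm. Then there is a caching algorithm $ALG$ (constructed using $A$ and $B$ only as black boxes) that is both $9\alpha$-robust and $9\gamma$-competitive.
   Context: Caching problem: there is a universe of elements and a cache (fast memory) holding at most $k$ elements. A sequence of requests $\sigma=z_1,z_2,\dots,z_n$ (fixed in advance, unknown to the algorithm) arrives online. If the requested element is in the cache there is no cost (cache hit); otherwise a cache miss occurs, costing $1$, and the element is placed into the cache, evicting some element if the cache is full. The cost of an algorithm is its number of cache misses; $\mathrm{OPT}$ denotes the minimum number of misses of an offline algorithm on $\sigma$. Predictions: when $z_i$ arrives, an oracle (a hypothesis $h$ applied to features of $z_i$) outputs a prediction $h_i\in\mathbb{N}^+$ of $y_i=\min\{\tau>i: z_\tau=z_i\}$ (with $y_i=n+1$ if $z_i$ is never requested again). For a loss function $\ell$, the total loss of the predictions on the instance is $\eta=\sum_i \ell(y_i,h_i)$. If an algorithm using the predictor achieves competitive ratio $c(\eta)$ (its cost is at most $c(\eta)$ times the offline optimum cost on every instance whose predictions have total loss $\eta$), then the algorithm is called $\alpha$-robust, for a function $\alpha(\eta)$, if $c(\eta)$ is non-decreasing and $c(\eta)=O(\alpha(\eta))$; it is called $\gamma$-competitive if $c(\eta)\le\gamma$ for all values of $\eta$, i.e., its cost is at most $\gamma$ times the offline optimum regardless of the predictions. *)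

theory Defs
  imports "HOL-Probability.Probability" "HOL-Library.Sublist" "HOL-Library.Landau_Symbols"
begin

text \<open>Demand paging: \<open>serve k C z C'\<close> says that a cache of size \<open>k\<close> with contents \<open>C\<close> can become
  \<open>C'\<close> when \<open>z\<close> is requested.\<close>

definition serve :: "nat \<Rightarrow> 'a set \<Rightarrow> 'a \<Rightarrow> 'a set \<Rightarrow> bool" where
  "serve k C z C' \<longleftrightarrow>
     (if z \<in> C then C' = C
      else if card C < k then C' = insert z C
      else \<exists>e\<in>C. C' = insert z (C - {e}))"

text \<open>\<open>Cs ! i\<close> is the cache after the first \<open>i\<close> requests; the cache is initially empty.\<close>

definition schedule :: "nat \<Rightarrow> 'a list \<Rightarrow> 'a set list \<Rightarrow> bool" where
  "schedule k zs Cs \<longleftrightarrow>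
     length Cs = length zs + 1 \<and> Cs ! 0 = {} \<and>
     (\<forall>i<length zs. serve k (Cs ! i) (zs ! i) (Cs ! Suc i))"

definition misses :: "'a list \<Rightarrow> 'a set list \<Rightarrow> nat" where
  "misses zs Cs = card {i. i < length zs \<and> zs ! i \<notin> Cs ! i}"

definition opt :: "nat \<Rightarrow> 'a list \<Rightarrow> nat" where
  "opt k zs = (LEAST m. \<exists>Cs. schedule k zs Cs \<and> m = misses zs Cs)"

text \<open>An instance is the list of pairs \<open>(z\<^sub>i, h\<^sub>i)\<close> of requests and their predictions.\<close>

definition wf_instance :: "('a \<times> nat) list \<Rightarrow> bool" where
  "wf_instance \<sigma> \<longleftrightarrow> (\<forall>(z, h)\<in>set \<sigma>. h > 0)"

text \<open>Times are numbered from 1, so the request at time \<open>i\<close> is \<open>zs ! (i - 1)\<close>.\<close>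

definition next_request :: "'a list \<Rightarrow> nat \<Rightarrow> nat" where
  "next_request zs i =
     (if \<exists>\<tau>>i. \<tau> \<le> length zs \<and> zs ! (\<tau> - 1) = zs ! (i - 1)
      then LEAST \<tau>. \<tau> > i \<and> \<tau> \<le> length zs \<and> zs ! (\<tau> - 1) = zs ! (i - 1)
      else length zs + 1)"

definition total_loss :: "(nat \<Rightarrow> nat \<Rightarrow> real) \<Rightarrow> ('a \<times> nat) list \<Rightarrow> real" where
  "total_loss \<L> \<sigma> =
     (\<Sum>i = 1..length \<sigma>. \<L> (next_request (map fst \<sigma>) i) (snd (\<sigma> ! (i - 1))))"

text \<open>A deterministic online algorithm maps the requests and predictions seen so far to the cache
  it holds after serving them.\<close>

type_synonym 'a alg = "('a \<times> nat) list \<Rightarrow> 'a set"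

definition trace :: "'a alg \<Rightarrow> ('a \<times> nat) list \<Rightarrow> 'a set list" where
  "trace A \<sigma> = map A (prefixes \<sigma>)"

definition deterministic_algorithm :: "nat \<Rightarrow> 'a alg \<Rightarrow> bool" where
  "deterministic_algorithm k A \<longleftrightarrow>
     (\<forall>\<sigma>. wf_instance \<sigma> \<longrightarrow> schedule k (map fst \<sigma>) (trace A \<sigma>))"

definition cost :: "'a alg \<Rightarrow> ('a \<times> nat) list \<Rightarrow> nat" where
  "cost A \<sigma> = misses (map fst \<sigma>) (trace A \<sigma>)"

text \<open>A possibly randomized algorithm is a random deterministic one, with the random bits drawn from
  \<open>M\<close>; its cost is the expected number of misses. Deterministic algorithms are the case of constant
  \<open>A\<close>.\<close>

definition caching_algorithm :: "nat \<Rightarrow> 'w measure \<Rightarrow> ('w \<Rightarrow> 'a alg) \<Rightarrow> bool" where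
  "caching_algorithm k M A \<longleftrightarrow>
     prob_space M \<and>
     (\<forall>\<omega>\<in>space M. deterministic_algorithm k (A \<omega>)) \<and>
     (\<forall>\<sigma>. wf_instance \<sigma> \<longrightarrow> (\<lambda>\<omega>. A \<omega> \<sigma>) \<in> measurable M (count_space UNIV))"

definition expected_cost :: "'w measure \<Rightarrow> ('w \<Rightarrow> 'a alg) \<Rightarrow> ('a \<times> nat) list \<Rightarrow> real" where
  "expected_cost M A \<sigma> = (\<integral>\<omega>. real (cost (A \<omega>) \<sigma>) \<partial>M)"

definition achieves_ratio ::
  "nat \<Rightarrow> (nat \<Rightarrow> nat \<Rightarrow> real) \<Rightarrow> 'w measure \<Rightarrow> ('w \<Rightarrow> 'a alg) \<Rightarrow> (real \<Rightarrow> real) \<Rightarrow> bool" where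
  "achieves_ratio k \<L> M A c \<longleftrightarrow>
     (\<forall>\<sigma>. wf_instance \<sigma> \<longrightarrow>
        expected_cost M A \<sigma> \<le> c (total_loss \<L> \<sigma>) * real (opt k (map fst \<sigma>)))"

definition robust ::
  "nat \<Rightarrow> (nat \<Rightarrow> nat \<Rightarrow> real) \<Rightarrow> 'w measure \<Rightarrow> ('w \<Rightarrow> 'a alg) \<Rightarrow> (real \<Rightarrow> real) \<Rightarrow> bool" where
  "robust k \<L> M A \<alpha> \<longleftrightarrow> (\<exists>c. achieves_ratio k \<L> M A c \<and> mono c \<and> c \<in> O(\<alpha>))"

definition competitive :: "nat \<Rightarrow> 'w measure \<Rightarrow> ('w \<Rightarrow> 'a alg) \<Rightarrow> real \<Rightarrow> bool" where
  "competitive k M A \<gamma> \<longleftrightarrow>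
     (\<forall>\<sigma>. wf_instance \<sigma> \<longrightarrow> expected_cost M A \<sigma> \<le> \<gamma> * real (opt k (map fst \<sigma>)))"

text \<open>Black-box access: the combined algorithm knows \<open>A\<close> and \<open>B\<close> only through the caches they have
  gone through on the input seen so far.\<close>

definition black_box ::
  "(('a \<times> nat) list \<Rightarrow> 'a set list \<Rightarrow> 'a set list \<Rightarrow> 'a set) \<Rightarrow> 'a alg \<Rightarrow> 'a alg \<Rightarrow> 'a alg" where
  "black_box F A B = (\<lambda>\<sigma>. F \<sigma> (trace A \<sigma>) (trace B \<sigma>))"

end

theory Submission imports Defs begin

text \<open>
  The combined algorithm simulates \<open>A\<close> and \<open>B\<close> and follows one of them lazily: on a miss with a full
  cache it evicts some element outside the cache of the algorithm it follows. As soon as the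
  followed algorithm has paid twice as much as the other one, the roles are exchanged.

  Let \<open>c\<close> be the cost of the combination so far, \<open>x\<close> and \<open>y\<close> the costs of the followed and of the
  other algorithm, and \<open>D\<close> the number of cached elements that the followed algorithm does not hold.
  Lazy following never increases \<open>c + D - x\<close>. An exchange resets \<open>D\<close> to at most \<open>y\<close>, because the
  other algorithm has had to load every element requested so far. It follows that \<open>c + D \<le> 5 x\<close> and
  \<open>c + D \<le> x + 2 y\<close> are maintained, exchanges (at which \<open>x = 2 y\<close>) included. With \<open>x \<le> 2 y\<close> this
  gives \<open>c \<le> 5 min x y\<close> for every outcome of the random bits, and one takes expectations.
\<close>

section \<open>Counting misses on a prefix of the requests\<close>

definition misses_upto :: "(nat \<Rightarrow> 'a) \<Rightarrow> (nat \<Rightarrow> 'a set) \<Rightarrow> nat \<Rightarrow> nat" where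
  "misses_upto z P n = card {i. i < n \<and> z i \<notin> P i}"

lemma misses_upto_0 [simp]: "misses_upto z P 0 = 0"
  by (simp add: misses_upto_def)

lemma misses_upto_Suc:
  "misses_upto z P (Suc n) = misses_upto z P n + (if z n \<in> P n then 0 else 1)"
proof -
  have "{i. i < Suc n \<and> z i \<notin> P i} =
      (if z n \<in> P n then {i. i < n \<and> z i \<notin> P i} else insert n {i. i < n \<and> z i \<notin> P i})"
    by (auto simp: less_Suc_eq)
  then show ?thesis
    by (simp add: misses_upto_def)
qed

lemma misses_upto_cong:
  assumes "\<And>i. i < n \<Longrightarrow> z i = z' i" "\<And>i. i < n \<Longrightarrow> P i = P' i"
  shows "misses_upto z P n = misses_upto z' P' n"
  unfolding misses_upto_def using assms by (intro arg_cong[where f = card]) auto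

lemma misses_eq_misses_upto: "misses zs Cs = misses_upto ((!) zs) ((!) Cs) (length zs)"
  by (simp add: misses_def misses_upto_def)

section \<open>Invariants of demand paging\<close>

text \<open>Demand paging evicts only when the cache is full. Hence the caches of any two algorithms
  always have equal size, and they coincide until they are full.\<close>

definition demand_cache :: "nat \<Rightarrow> 'a set \<Rightarrow> 'a set \<Rightarrow> bool" where
  "demand_cache k R C \<longleftrightarrow> finite R \<and> C \<subseteq> R \<and> card C \<le> k \<and> (card C < k \<longrightarrow> C = R)"

lemma demand_cache_empty: "demand_cache k {} {}"
  by (simp add: demand_cache_def)

text \<open>An eviction happens only at size \<open>k\<close> and is paired with an insertion, so a
  cache that has become full stays full and the last clause of \<open>demand_cache\<close> holds
  vacuously from then on.\<close>

lemma demand_cache_serve: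
  assumes "demand_cache k R C" "serve k C z C'"
  shows "demand_cache k (insert z R) C'"
proof -
  have fin: "finite C"
    using assms(1) finite_subset unfolding demand_cache_def by blast
  consider "z \<in> C" "C' = C" | "z \<notin> C" "card C < k" "C' = insert z C"
    | e where "z \<notin> C" "\<not> card C < k" "e \<in> C" "C' = insert z (C - {e})"
    using assms(2) by (auto simp: serve_def split: if_splits)
  then show ?thesis
  proof cases
    case 1
    then show ?thesis using assms(1) by (auto simp: demand_cache_def)
  next
    case 2
    then show ?thesis using assms(1) fin by (auto simp: demand_cache_def)
  next
    case 3
    have "card (insert z (C - {e})) = card C"
      using 3 fin card_Suc_Diff1[of C e] by simp
    then show ?thesis using 3 assms(1) by (auto simp: demand_cache_def)
  qed
qed

text \<open>Both sizes equal the minimum of \<open>k\<close> and \<open>card R\<close>.\<close>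

lemma demand_cache_card_eq:
  assumes "demand_cache k R C" "demand_cache k R T"
  shows "card C = card T"
proof -
  have "card X \<le> card Y" if "demand_cache k R X" "demand_cache k R Y" for X Y
  proof (cases "card Y < k")
    case True
    then have "Y = R" using that(2) by (simp add: demand_cache_def)
    then show ?thesis using that(1) by (auto simp: demand_cache_def intro: card_mono)
  next
    case False
    then show ?thesis using that(1) by (simp add: demand_cache_def)
  qed
  then show ?thesis using assms by (simp add: le_antisym)
qed

lemma served_in_cache: "serve k C z C' \<Longrightarrow> z \<in> C'"
  by (auto simp: serve_def split: if_splits)

text \<open>An element of \<open>C\<close> can newly fall outside the other cache only by being
  evicted there, and each miss evicts at most one element.\<close>

lemma card_diff_serve_le:
  assumes "serve k T z T'" "finite C"
  shows "card (C - T') \<le> card (C - T) + (if z \<in> T then 0 else 1)"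
proof (cases "z \<in> T")
  case True
  then show ?thesis using assms by (simp add: serve_def)
next
  case False
  then obtain e where "C - T' \<subseteq> insert e (C - T)"
    using assms(1) by (auto simp: serve_def split: if_splits)
  then have "card (C - T') \<le> card (insert e (C - T))"
    using assms(2) by (intro card_mono) auto
  also have "\<dots> \<le> card (C - T) + 1"
    using assms(2) by (simp add: card_insert_if)
  finally show ?thesis using False by simp
qed

section \<open>Lazily following one algorithm\<close>

text \<open>The second argument is the cache of the followed algorithm \<^emph>\<open>after\<close> it has served the
  request.\<close>

definition lazy_serve :: "nat \<Rightarrow> 'a set \<Rightarrow> 'a \<Rightarrow> 'a set \<Rightarrow> 'a set" where
  "lazy_serve k T' z C =
     (if z \<in> C then C
      else if card C < k then insert z C
      else insert z (C - {SOME e. e \<in> C - T'}))"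

text \<open>Were \<open>C\<close> contained in \<open>T'\<close>, the containment would be proper
  because \<open>z\<close> lies in \<open>T'\<close> but not in \<open>C\<close>; then
  \<open>card C < card T' \<le> k\<close>, although \<open>C\<close> is full.\<close>

lemma lazy_serve_victim:
  assumes "demand_cache k R C" "demand_cache k R T" "serve k T z T'" "z \<notin> C" "\<not> card C < k"
  shows "(SOME e. e \<in> C - T') \<in> C - T'"
proof -
  have T': "demand_cache k (insert z R) T'"
    using assms(2,3) by (rule demand_cache_serve)
  have "finite T'" "card T' \<le> k"
    using T' finite_subset unfolding demand_cache_def by (blast, simp)
  then have "\<not> C \<subset> T'"
    using psubset_card_mono[of T' C] assms(5) by linarith
  then have "\<exists>e. e \<in> C - T'"
    using served_in_cache[OF assms(3)] assms(4) by blast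
  then show ?thesis by (rule someI_ex)
qed

lemma serve_lazy_serve:
  assumes "demand_cache k R C" "demand_cache k R T" "serve k T z T'"
  shows "serve k C z (lazy_serve k T' z C)"
  using lazy_serve_victim[OF assms] unfolding serve_def lazy_serve_def by auto

text \<open>This is the amortized step for c + D - x. On a miss with a full cache the victim lies
  outside \<open>T'\<close> and \<open>z\<close> inside, so the distance to \<open>T'\<close> drops
  by one and pays for the miss.\<close>

lemma lazy_serve_potential:
  assumes "demand_cache k R C" "demand_cache k R T" "serve k T z T'"
  shows "(if z \<in> C then 0 else 1) + card (lazy_serve k T' z C - T')
           \<le> card (C - T) + (if z \<in> T then 0 else 1)"
proof -
  have fin: "finite C"
    using assms(1) finite_subset unfolding demand_cache_def by blast
  have z: "z \<in> T'" using assms(3) by (rule served_in_cache)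
  note le = card_diff_serve_le[OF assms(3) fin]
  consider "z \<in> C" | "z \<notin> C" "card C < k" | "z \<notin> C" "\<not> card C < k" by blast
  then show ?thesis
  proof cases
    case 1
    then show ?thesis using le by (simp add: lazy_serve_def)
  next
    case 2
    then have "card T < k" using demand_cache_card_eq[OF assms(1,2)] by simp
    \<comment> \<open>Below capacity both caches hold everything requested so far, so both miss and
      they stay equal.\<close>
    then have "T = C" using 2 assms(1,2) by (auto simp: demand_cache_def)
    then show ?thesis using 2 assms(3) by (simp add: lazy_serve_def serve_def)
  next
    case 3
    define e where "e = (SOME e. e \<in> C - T')"
    have e: "e \<in> C - T'"
      unfolding e_def using lazy_serve_victim[OF assms 3] .
    have "lazy_serve k T' z C - T' = (C - T') - {e}"
      using 3 z by (auto simp: lazy_serve_def e_def)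
    moreover have "Suc (card ((C - T') - {e})) = card (C - T')"
      using e fin by (intro card_Suc_Diff1) auto
    ultimately show ?thesis using le 3 by simp
  qed
qed

section \<open>The combination and its cost invariant\<close>

text \<open>The Boolean component of the state tells whether \<open>P\<close> (rather than \<open>Q\<close>) is followed.\<close>

primrec combine ::
  "nat \<Rightarrow> (nat \<Rightarrow> 'a) \<Rightarrow> (nat \<Rightarrow> 'a set) \<Rightarrow> (nat \<Rightarrow> 'a set) \<Rightarrow> nat \<Rightarrow> 'a set \<times> bool" where
  "combine k z P Q 0 = ({}, True)"
| "combine k z P Q (Suc n) =
     (let (C, m) = combine k z P Q n;
          p = misses_upto z P (Suc n);
          q = misses_upto z Q (Suc n)
      in (lazy_serve k (if m then P (Suc n) else Q (Suc n)) (z n) C,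
          if m then p < 2 * q else 2 * p \<le> q))"

text \<open>The combination is online: its state depends only on the past. This lets a run on a
  prefix be identified with the run on the whole input.\<close>

lemma combine_cong:
  assumes "\<And>i. i < n \<Longrightarrow> z i = z' i" "\<And>i. i \<le> n \<Longrightarrow> P i = P' i" "\<And>i. i \<le> n \<Longrightarrow> Q i = Q' i"
  shows "combine k z P Q n = combine k z' P' Q' n"
  using assms
proof (induction n)
  case (Suc n)
  have "combine k z P Q n = combine k z' P' Q' n"
    using Suc by simp
  moreover have "misses_upto z P (Suc n) = misses_upto z' P' (Suc n)"
    "misses_upto z Q (Suc n) = misses_upto z' Q' (Suc n)"
    using Suc.prems by (auto intro!: misses_upto_cong)
  moreover have "z n = z' n" "P (Suc n) = P' (Suc n)" "Q (Suc n) = Q' (Suc n)"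
    using Suc.prems by auto
  ultimately show ?case by (simp only: combine.simps)
qed simp

text \<open>Here \<open>x\<close> belongs to the followed algorithm and \<open>y\<close> to the
  other one. The first clause bounds the cost against \<open>x\<close>; the other two bound it by
  \<open>4 * y\<close>. The strict inequality fails at the start, hence the extra disjunct.\<close>

definition follow_invariant :: "nat \<Rightarrow> nat \<Rightarrow> nat \<Rightarrow> nat \<Rightarrow> bool" where
  "follow_invariant c D x y \<longleftrightarrow>
     c + D \<le> 5 * x \<and> c + D \<le> x + 2 * y \<and> (x < 2 * y \<or> x = 0 \<and> y = 0)"

text \<open>Since costs grow by at most one per request, an exchange happens exactly at equality,
  with \<open>dy = 0\<close> and \<open>x + dx = 2 * y\<close>. Then \<open>c' \<le> 4 * y\<close>,
  and the new distance \<open>E \<le> y\<close> brings the sum to at most \<open>5 * y\<close>,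
  which satisfies both bounds with the roles exchanged.\<close>

lemma follow_invariant_step:
  assumes "follow_invariant c D x y" "c' + D' \<le> c + D + dx" "dx \<le> 1"
    and "x = 0 \<and> y = 0 \<Longrightarrow> dx = 1 \<and> dy = 1" "E \<le> y + dy"
  shows "if x + dx < 2 * (y + dy) then follow_invariant c' D' (x + dx) (y + dy)
         else follow_invariant c' E (y + dy) (x + dx)"
  using assms unfolding follow_invariant_def by (auto split: if_splits)

text \<open>The bound \<open>N\<close> is there because \<open>P\<close> and \<open>Q\<close> will
  be list lookups, which are meaningful only up to the length of the input.\<close>

locale two_schedules =
  fixes k :: nat and z :: "nat \<Rightarrow> 'a" and P Q :: "nat \<Rightarrow> 'a set" and N :: nat
  assumes P0: "P 0 = {}" and Q0: "Q 0 = {}"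
    and P_serve: "\<And>i. i < N \<Longrightarrow> serve k (P i) (z i) (P (Suc i))"
    and Q_serve: "\<And>i. i < N \<Longrightarrow> serve k (Q i) (z i) (Q (Suc i))"
begin

abbreviation "cache n \<equiv> fst (combine k z P Q n)"
abbreviation "follows_P n \<equiv> snd (combine k z P Q n)"

lemma cache_Suc:
  "cache (Suc n) = lazy_serve k ((if follows_P n then P else Q) (Suc n)) (z n) (cache n)"
  by (simp add: split_beta Let_def)

lemma demand_caches:
  assumes "n \<le> N"
  shows "demand_cache k (z ` {..<n}) (P n) \<and> demand_cache k (z ` {..<n}) (Q n) \<and>
    demand_cache k (z ` {..<n}) (cache n)"
  using assms
proof (induction n)
  case 0
  then show ?case by (simp add: P0 Q0 demand_cache_empty)
next
  case (Suc n)
  then have n: "n < N" by simp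
  let ?T = "if follows_P n then P else Q"
  have IH: "demand_cache k (z ` {..<n}) (P n)" "demand_cache k (z ` {..<n}) (Q n)"
    "demand_cache k (z ` {..<n}) (cache n)" using Suc by auto
  have "serve k (cache n) (z n) (cache (Suc n))"
    unfolding cache_Suc using IH P_serve[OF n] Q_serve[OF n]
    by (intro serve_lazy_serve[where R = "z ` {..<n}" and T = "?T n"]) auto
  then show ?case
    using demand_cache_serve[OF IH(1) P_serve[OF n]] demand_cache_serve[OF IH(2) Q_serve[OF n]]
      demand_cache_serve[OF IH(3)]
    unfolding lessThan_Suc image_insert by simp
qed

lemma serve_cache:
  assumes "n < N"
  shows "serve k (cache n) (z n) (cache (Suc n))"
proof -
  let ?T = "if follows_P n then P else Q"
  show ?thesis
    unfolding cache_Suc using demand_caches[of n] P_serve[OF assms] Q_serve[OF assms] assms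
    by (intro serve_lazy_serve[where R = "z ` {..<n}" and T = "?T n"]) auto
qed

lemma potential_step:
  assumes "n < N" and T: "T = (if follows_P n then P else Q)"
  shows "misses_upto z cache (Suc n) + card (cache (Suc n) - T (Suc n))
    \<le> misses_upto z cache n + card (cache n - T n) + (if z n \<in> T n then 0 else 1)"
proof -
  have "(if z n \<in> cache n then 0 else 1) + card (lazy_serve k (T (Suc n)) (z n) (cache n) - T (Suc n))
      \<le> card (cache n - T n) + (if z n \<in> T n then 0 else 1)"
    using demand_caches[of n] P_serve Q_serve assms
    by (intro lazy_serve_potential[where R = "z ` {..<n}"]) auto
  then show ?thesis
    unfolding misses_upto_Suc cache_Suc T[symmetric] by linarith
qed

text \<open>A requested element that is absent from the cache has been evicted, and evictions are at
  most as many as misses.\<close>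

lemma card_requested_diff_le_misses:
  assumes "n \<le> N" "T \<in> {P, Q}"
  shows "card (z ` {..<n} - T n) \<le> misses_upto z T n"
  using assms
proof (induction n)
  case (Suc n)
  have T: "serve k (T n) (z n) (T (Suc n))"
    using Suc.prems P_serve Q_serve by auto
  \<comment> \<open>The newest request has just been served, so it adds nothing to the
    difference.\<close>
  have "z ` {..<Suc n} - T (Suc n) = z ` {..<n} - T (Suc n)"
    using served_in_cache[OF T] by (auto simp: lessThan_Suc)
  then have "card (z ` {..<Suc n} - T (Suc n))
      \<le> card (z ` {..<n} - T n) + (if z n \<in> T n then 0 else 1)"
    using card_diff_serve_le[OF T, of "z ` {..<n}"] by simp
  also have "\<dots> \<le> misses_upto z T (Suc n)"
    using Suc by (simp add: misses_upto_Suc)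
  finally show ?case .
qed simp

lemma card_cache_diff_le_misses:
  assumes "n \<le> N" "T \<in> {P, Q}"
  shows "card (cache n - T n) \<le> misses_upto z T n"
proof -
  have "card (cache n - T n) \<le> card (z ` {..<n} - T n)"
    using demand_caches[OF assms(1)] by (intro card_mono) (auto simp: demand_cache_def)
  then show ?thesis
    using card_requested_diff_le_misses[OF assms] by linarith
qed

lemma no_misses_imp_start:
  assumes "n \<le> N" "misses_upto z P n = 0"
  shows "n = 0"
proof (rule ccontr)
  assume "n \<noteq> 0"
  then have "0 \<in> {i. i < n \<and> z i \<notin> P i}" by (simp add: P0)
  then show False
    using assms(2) by (auto simp: misses_upto_def card_eq_0_iff)
qed

lemma invariant:
  assumes "n \<le> N"
  shows "if follows_P n
    then follow_invariant (misses_upto z cache n) (card (cache n - P n))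
           (misses_upto z P n) (misses_upto z Q n)
    else follow_invariant (misses_upto z cache n) (card (cache n - Q n))
           (misses_upto z Q n) (misses_upto z P n)"
  using assms
proof (induction n)
  case 0
  then show ?case by (simp add: follow_invariant_def)
next
  case (Suc n)
  then have n: "n < N" by simp
  define dp dq where "dp = (if z n \<in> P n then 0 else (1::nat))"
    and "dq = (if z n \<in> Q n then 0 else (1::nat))"
  have p: "misses_upto z P (Suc n) = misses_upto z P n + dp"
    and q: "misses_upto z Q (Suc n) = misses_upto z Q n + dq"
    by (simp_all add: misses_upto_Suc dp_def dq_def)
  have d: "dp \<le> 1" "dq \<le> 1" by (auto simp: dp_def dq_def)
  \<comment> \<open>Zero misses of \<open>P\<close> means that no request has come yet; the first
    request then misses in both empty caches.\<close>
  have start: "dp = 1 \<and> dq = 1" if "misses_upto z P n = 0"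
    using no_misses_imp_start[OF less_imp_le[OF n] that] by (simp add: dp_def dq_def P0 Q0)
  have EP: "card (cache (Suc n) - P (Suc n)) \<le> misses_upto z P n + dp"
    and EQ: "card (cache (Suc n) - Q (Suc n)) \<le> misses_upto z Q n + dq"
    using card_cache_diff_le_misses[OF Suc.prems, of P]
      card_cache_diff_le_misses[OF Suc.prems, of Q] p q by auto
  show ?case
  proof (cases "follows_P n")
    case True
    have "follows_P (Suc n) \<longleftrightarrow> misses_upto z P n + dp < 2 * (misses_upto z Q n + dq)"
      using True by (simp add: split_beta Let_def p q)
    moreover have "misses_upto z cache (Suc n) + card (cache (Suc n) - P (Suc n))
        \<le> misses_upto z cache n + card (cache n - P n) + dp"
      using potential_step[OF n refl] True by (simp add: dp_def del: combine.simps)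
    moreover have "follow_invariant (misses_upto z cache n) (card (cache n - P n))
        (misses_upto z P n) (misses_upto z Q n)"
      using Suc True by simp
    \<comment> \<open>Both outcomes of the exchange test are covered at once; \<open>EQ\<close>
      supplies the distance to \<open>Q\<close> in case of an exchange.\<close>
    ultimately show ?thesis
      using follow_invariant_step[OF _ _ d(1) _ EQ] start unfolding p q by presburger
  next
    case False
    have "follows_P (Suc n) \<longleftrightarrow> \<not> misses_upto z Q n + dq < 2 * (misses_upto z P n + dp)"
      using False by (simp add: split_beta Let_def p q not_less)
    moreover have "misses_upto z cache (Suc n) + card (cache (Suc n) - Q (Suc n))
        \<le> misses_upto z cache n + card (cache n - Q n) + dq"
      using potential_step[OF n refl] False by (simp add: dq_def del: combine.simps)
    moreover have "follow_invariant (misses_upto z cache n) (card (cache n - Q n))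
        (misses_upto z Q n) (misses_upto z P n)"
      using Suc False by simp
    ultimately show ?thesis
      using follow_invariant_step[OF _ _ d(2) _ EP] start unfolding p q by presburger
  qed
qed

text \<open>Which of the two is followed at time \<open>N\<close> is unknown, but the invariant
  bounds the cost against either role.\<close>

lemma misses_cache_le:
  "misses_upto z cache N \<le> 5 * misses_upto z P N"
  "misses_upto z cache N \<le> 5 * misses_upto z Q N"
  using invariant[of N] by (auto simp: follow_invariant_def split: if_splits)

end

section \<open>The combination as a black-box online algorithm\<close>

text \<open>An algorithm returns only a cache, so the Boolean state cannot be carried along; the run
  is recomputed from the start on every prefix.\<close>

definition combine_lists ::
  "nat \<Rightarrow> ('a \<times> nat) list \<Rightarrow> 'a set list \<Rightarrow> 'a set list \<Rightarrow> 'a set" where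
  "combine_lists k \<sigma> As Bs = fst (combine k (\<lambda>i. fst (\<sigma> ! i)) ((!) As) ((!) Bs) (length \<sigma>))"

lemma length_trace [simp]: "length (trace A \<sigma>) = Suc (length \<sigma>)"
  by (simp add: trace_def)

lemma nth_prefixes: "i \<le> length xs \<Longrightarrow> prefixes xs ! i = take i xs"
proof (induction xs arbitrary: i)
  case (Cons x xs)
  then show ?case by (cases i) auto
qed simp

lemma nth_trace: "i \<le> length \<sigma> \<Longrightarrow> trace A \<sigma> ! i = A (take i \<sigma>)"
  by (simp add: trace_def nth_prefixes)

lemma cost_eq_misses_upto:
  "cost A \<sigma> = misses_upto (\<lambda>i. fst (\<sigma> ! i)) ((!) (trace A \<sigma>)) (length \<sigma>)"
  unfolding cost_def misses_eq_misses_upto by (auto intro!: misses_upto_cong)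

lemma cost_le_length: "cost A \<sigma> \<le> length \<sigma>"
proof -
  have "cost A \<sigma> \<le> card {..<length \<sigma>}"
    unfolding cost_def misses_def by (rule card_mono) auto
  then show ?thesis by simp
qed

text \<open>Entry \<open>i\<close> comes from a separate run on \<open>take i \<sigma>\<close>; by
  \<open>combine_cong\<close> these runs fit together into the single run on
  \<open>\<sigma>\<close>.\<close>

lemma nth_trace_black_box:
  assumes "i \<le> length \<sigma>"
  shows "trace (black_box (combine_lists k) A B) \<sigma> ! i =
    fst (combine k (\<lambda>i. fst (\<sigma> ! i)) ((!) (trace A \<sigma>)) ((!) (trace B \<sigma>)) i)"
  using assms unfolding nth_trace[OF assms] black_box_def combine_lists_def
  by (auto intro!: arg_cong[where f = fst] combine_cong simp: nth_trace min_absorb2)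

lemma two_schedules_traces:
  assumes "deterministic_algorithm k A" "deterministic_algorithm k B" "wf_instance \<sigma>"
  shows "two_schedules k (\<lambda>i. fst (\<sigma> ! i)) ((!) (trace A \<sigma>)) ((!) (trace B \<sigma>)) (length \<sigma>)"
  using assms by unfold_locales (auto simp: deterministic_algorithm_def schedule_def)

lemma deterministic_algorithm_black_box:
  assumes "deterministic_algorithm k A" "deterministic_algorithm k B"
  shows "deterministic_algorithm k (black_box (combine_lists k) A B)"
  unfolding deterministic_algorithm_def
proof (intro allI impI)
  fix \<sigma> :: "('a \<times> nat) list"
  assume "wf_instance \<sigma>"
  then interpret two_schedules k "\<lambda>i. fst (\<sigma> ! i)" "(!) (trace A \<sigma>)" "(!) (trace B \<sigma>)" "length \<sigma>"
    using assms two_schedules_traces by blast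
  show "schedule k (map fst \<sigma>) (trace (black_box (combine_lists k) A B) \<sigma>)"
    using serve_cache by (simp add: schedule_def nth_trace_black_box del: combine.simps(2))
qed

lemma cost_black_box_le:
  assumes "deterministic_algorithm k A" "deterministic_algorithm k B" "wf_instance \<sigma>"
  shows "cost (black_box (combine_lists k) A B) \<sigma> \<le> 5 * cost A \<sigma>"
    and "cost (black_box (combine_lists k) A B) \<sigma> \<le> 5 * cost B \<sigma>"
proof -
  interpret two_schedules k "\<lambda>i. fst (\<sigma> ! i)" "(!) (trace A \<sigma>)" "(!) (trace B \<sigma>)" "length \<sigma>"
    using assms by (rule two_schedules_traces)
  have "cost (black_box (combine_lists k) A B) \<sigma> =
      misses_upto (\<lambda>i. fst (\<sigma> ! i)) cache (length \<sigma>)"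
    unfolding cost_eq_misses_upto by (rule misses_upto_cong) (simp_all add: nth_trace_black_box)
  then show "cost (black_box (combine_lists k) A B) \<sigma> \<le> 5 * cost A \<sigma>"
    and "cost (black_box (combine_lists k) A B) \<sigma> \<le> 5 * cost B \<sigma>"
    using misses_cache_le unfolding cost_eq_misses_upto[of A] cost_eq_misses_upto[of B] by simp_all
qed

section \<open>Measurability of the traces\<close>

lemma schedule_subset_requests:
  assumes "schedule k zs Cs" "i \<le> length zs"
  shows "Cs ! i \<subseteq> set zs"
  using assms(2)
proof (induction i)
  case 0
  then show ?case using assms(1) by (simp add: schedule_def)
next
  case (Suc i)
  then have "serve k (Cs ! i) (zs ! i) (Cs ! Suc i)"
    using assms(1) by (simp add: schedule_def)
  then have "Cs ! Suc i \<subseteq> insert (zs ! i) (Cs ! i)"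
    by (auto simp: serve_def split: if_splits)
  then show ?case using Suc by auto
qed

text \<open>Caches contain only requested elements, which leaves finitely many candidate traces,
  uniformly in the random bits.\<close>

lemma trace_in_finite_set:
  assumes "deterministic_algorithm k A" "wf_instance \<sigma>"
  shows "trace A \<sigma> \<in> {xs. set xs \<subseteq> Pow (fst ` set \<sigma>) \<and> length xs = Suc (length \<sigma>)}"
proof -
  have "schedule k (map fst \<sigma>) (trace A \<sigma>)"
    using assms by (simp add: deterministic_algorithm_def)
  then have "trace A \<sigma> ! i \<subseteq> fst ` set \<sigma>" if "i \<le> length \<sigma>" for i
    using schedule_subset_requests[of k "map fst \<sigma>" "trace A \<sigma>" i] that by simp
  then show ?thesis
    by (fastforce simp: in_set_conv_nth less_Suc_eq_le)
qed

text \<open>Equality with a fixed list is a finite intersection of events that each fix one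
  entry.\<close>

lemma sets_map_eq:
  assumes "\<And>p. p \<in> set ps \<Longrightarrow> (\<lambda>\<omega>. A \<omega> p) \<in> measurable M (count_space UNIV)"
  shows "{\<omega> \<in> space M. map (A \<omega>) ps = xs} \<in> sets M"
  using assms
proof (induction ps arbitrary: xs)
  case Nil
  then show ?case by simp
next
  case (Cons p ps)
  show ?case
  proof (cases xs)
    case Nil
    then show ?thesis by simp
  next
    case (Cons y ys)
    have "(\<lambda>\<omega>. A \<omega> p) -` {y} \<inter> space M \<in> sets M"
      using Cons.prems by (intro measurable_sets[where A = "count_space UNIV"]) auto
    moreover have "{\<omega> \<in> space M. map (A \<omega>) ps = ys} \<in> sets M"
      using Cons.IH Cons.prems by simp
    moreover have "{\<omega> \<in> space M. map (A \<omega>) (p # ps) = xs} =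
        ((\<lambda>\<omega>. A \<omega> p) -` {y} \<inter> space M) \<inter> {\<omega> \<in> space M. map (A \<omega>) ps = ys}"
      using Cons by auto
    ultimately show ?thesis by simp
  qed
qed

lemma sets_trace_eq:
  assumes "caching_algorithm k M A" "wf_instance \<sigma>"
  shows "{\<omega> \<in> space M. trace (A \<omega>) \<sigma> = xs} \<in> sets M"
  unfolding trace_def
proof (rule sets_map_eq)
  fix p assume "p \<in> set (prefixes \<sigma>)"
  then have "wf_instance p"
    using assms(2) set_mono_prefix unfolding wf_instance_def by fastforce
  then show "(\<lambda>\<omega>. A \<omega> p) \<in> measurable M (count_space UNIV)"
    using assms(1) by (simp add: caching_algorithm_def)
qed

text \<open>The type of caches may be uncountable, so measurability of a function of both traces rests on
  the traces taking only finitely many values on a fixed instance.\<close>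

lemma measurable_traces:
  assumes "caching_algorithm k M A" "caching_algorithm k M B" "wf_instance \<sigma>"
  shows "(\<lambda>\<omega>. g (trace (A \<omega>) \<sigma>) (trace (B \<omega>) \<sigma>)) \<in> measurable M (count_space UNIV)"
proof (rule measurableI)
  fix X
  define S where "S = {xs. set xs \<subseteq> Pow (fst ` set \<sigma>) \<and> length xs = Suc (length \<sigma>)}"
  have "finite S"
    unfolding S_def by (intro finite_lists_length_eq) auto
  then have fin: "finite {(x, y). (x, y) \<in> S \<times> S \<and> g x y \<in> X}"
    by (rule_tac finite_subset[of _ "S \<times> S"]) auto
  have S: "trace (A \<omega>) \<sigma> \<in> S" "trace (B \<omega>) \<sigma> \<in> S" if "\<omega> \<in> space M" for \<omega>
    using that assms trace_in_finite_set unfolding caching_algorithm_def S_def by blast+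
  have "(\<lambda>\<omega>. g (trace (A \<omega>) \<sigma>) (trace (B \<omega>) \<sigma>)) -` X \<inter> space M =
      (\<Union>p\<in>{(x, y). (x, y) \<in> S \<times> S \<and> g x y \<in> X}.
        {\<omega> \<in> space M. trace (A \<omega>) \<sigma> = fst p} \<inter> {\<omega> \<in> space M. trace (B \<omega>) \<sigma> = snd p})"
    using S by auto
  also have "\<dots> \<in> sets M"
    using fin sets_trace_eq[OF assms(1,3)] sets_trace_eq[OF assms(2,3)]
    by (intro sets.finite_UN sets.Int) auto
  finally show "(\<lambda>\<omega>. g (trace (A \<omega>) \<sigma>) (trace (B \<omega>) \<sigma>)) -` X \<inter> space M \<in> sets M" .
qed simp

lemma caching_algorithm_black_box:
  fixes A B :: "'w \<Rightarrow> 'a alg"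
  assumes "caching_algorithm k M A" "caching_algorithm k M B"
  shows "caching_algorithm k M (\<lambda>\<omega>. black_box (combine_lists k) (A \<omega>) (B \<omega>))"
  unfolding caching_algorithm_def
proof (intro conjI ballI allI impI)
  show "prob_space M" using assms(1) by (simp add: caching_algorithm_def)
next
  fix \<omega> assume "\<omega> \<in> space M"
  then show "deterministic_algorithm k (black_box (combine_lists k) (A \<omega>) (B \<omega>))"
    using assms by (intro deterministic_algorithm_black_box) (auto simp: caching_algorithm_def)
next
  fix \<sigma> :: "('a \<times> nat) list" assume "wf_instance \<sigma>"
  then show "(\<lambda>\<omega>. black_box (combine_lists k) (A \<omega>) (B \<omega>) \<sigma>) \<in> measurable M (count_space UNIV)"
    unfolding black_box_def using assms by (intro measurable_traces)
qed

section \<open>Expected costs\<close>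

lemma integrable_cost:
  assumes "caching_algorithm k M A" "wf_instance \<sigma>"
  shows "integrable M (\<lambda>\<omega>. real (cost (A \<omega>) \<sigma>))"
proof -
  interpret prob_space M using assms(1) by (simp add: caching_algorithm_def)
  have "(\<lambda>\<omega>. cost (A \<omega>) \<sigma>) \<in> measurable M (count_space UNIV)"
    \<comment> \<open>Only one trace matters here, so \<open>A\<close> fills both slots and the
      second argument is ignored.\<close>
    using measurable_traces[OF assms(1,1,2), of "\<lambda>x y. misses (map fst \<sigma>) x"]
    by (simp add: cost_def)
  then have "(\<lambda>\<omega>. real (cost (A \<omega>) \<sigma>)) \<in> borel_measurable M"
    by (rule measurable_compose) simp
  then show ?thesis
    using cost_le_length by (intro integrable_const_bound[where B = "real (length \<sigma>)"]) auto
qed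

lemma expected_cost_mono:
  assumes "caching_algorithm k M A" "caching_algorithm k M B" "wf_instance \<sigma>"
    and "\<And>\<omega>. \<omega> \<in> space M \<Longrightarrow> cost (A \<omega>) \<sigma> \<le> c * cost (B \<omega>) \<sigma>"
  shows "expected_cost M A \<sigma> \<le> real c * expected_cost M B \<sigma>"
proof -
  have "expected_cost M A \<sigma> \<le> (\<integral>\<omega>. real c * real (cost (B \<omega>) \<sigma>) \<partial>M)"
    unfolding expected_cost_def
    using assms integrable_cost
    by (intro integral_mono integrable_mult_right) (auto simp flip: of_nat_mult)
  then show ?thesis by (simp add: expected_cost_def)
qed

lemma expected_cost_nonneg: "expected_cost M A \<sigma> \<ge> 0"
  by (simp add: expected_cost_def)

lemma expected_cost_black_box_le:
  assumes "caching_algorithm k M A" "caching_algorithm k M B" "wf_instance \<sigma>"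
  defines "ALG \<equiv> \<lambda>\<omega>. black_box (combine_lists k) (A \<omega>) (B \<omega>)"
  shows "expected_cost M ALG \<sigma> \<le> 5 * expected_cost M A \<sigma>"
    and "expected_cost M ALG \<sigma> \<le> 5 * expected_cost M B \<sigma>"
proof -
  have ALG: "caching_algorithm k M ALG"
    unfolding ALG_def using assms(1,2) by (rule caching_algorithm_black_box)
  have le: "cost (ALG \<omega>) \<sigma> \<le> 5 * cost (A \<omega>) \<sigma>" "cost (ALG \<omega>) \<sigma> \<le> 5 * cost (B \<omega>) \<sigma>"
    if "\<omega> \<in> space M" for \<omega>
    using that assms(1-3) cost_black_box_le unfolding ALG_def caching_algorithm_def by blast+
  show "expected_cost M ALG \<sigma> \<le> 5 * expected_cost M A \<sigma>"
    using expected_cost_mono[OF ALG assms(1,3), of 5] le by simp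
  show "expected_cost M ALG \<sigma> \<le> 5 * expected_cost M B \<sigma>"
    using expected_cost_mono[OF ALG assms(2,3), of 5] le by simp
qed

text \<open>One \<open>F\<close>, depending on \<open>k\<close> alone, serves all losses,
  probability spaces and algorithms. The last conjunct records the factor 9 for the ratio functions
  themselves, since O-notation absorbs constants.\<close>

theorem theorem1:
  fixes k :: nat
  assumes "k \<ge> 1"
  shows "\<exists>F :: ('a \<times> nat) list \<Rightarrow> 'a set list \<Rightarrow> 'a set list \<Rightarrow> 'a set.
    \<forall>(\<L> :: nat \<Rightarrow> nat \<Rightarrow> real) (M :: 'w measure) (A :: 'w \<Rightarrow> 'a alg) (B :: 'w \<Rightarrow> 'a alg)
      (\<alpha> :: real \<Rightarrow> real) (\<gamma> :: real).
      caching_algorithm k M A \<longrightarrow> robust k \<L> M A \<alpha> \<longrightarrow>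
      caching_algorithm k M B \<longrightarrow> competitive k M B \<gamma> \<longrightarrow>
      (let ALG = (\<lambda>\<omega>. black_box F (A \<omega>) (B \<omega>)) in
         caching_algorithm k M ALG \<and>
         robust k \<L> M ALG (\<lambda>\<eta>. 9 * \<alpha> \<eta>) \<and>
         competitive k M ALG (9 * \<gamma>) \<and>
         (\<forall>c. achieves_ratio k \<L> M A c \<longrightarrow> achieves_ratio k \<L> M ALG (\<lambda>\<eta>. 9 * c \<eta>)))"
proof (intro exI[of _ "combine_lists k"] allI impI)
  fix \<L> :: "nat \<Rightarrow> nat \<Rightarrow> real" and M :: "'w measure" and A B :: "'w \<Rightarrow> 'a alg"
    and \<alpha> :: "real \<Rightarrow> real" and \<gamma> :: real
  assume A: "caching_algorithm k M A" and rob: "robust k \<L> M A \<alpha>"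
    and B: "caching_algorithm k M B" and comp: "competitive k M B \<gamma>"
  define ALG where "ALG = (\<lambda>\<omega>. black_box (combine_lists k) (A \<omega>) (B \<omega>))"
  \<comment> \<open>The constant 5 weakens to 9 because expected costs are nonnegative.\<close>
  have le: "expected_cost M ALG \<sigma> \<le> 9 * expected_cost M A \<sigma>"
    "expected_cost M ALG \<sigma> \<le> 9 * expected_cost M B \<sigma>" if "wf_instance \<sigma>" for \<sigma>
    using expected_cost_black_box_le[OF A B that] expected_cost_nonneg[of M A \<sigma>]
      expected_cost_nonneg[of M B \<sigma>] unfolding ALG_def by linarith+
  have ratio: "achieves_ratio k \<L> M ALG (\<lambda>\<eta>. 9 * c \<eta>)" if "achieves_ratio k \<L> M A c" for c
    using that le(1) unfolding achieves_ratio_def by (force simp: mult.assoc)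
  have "robust k \<L> M ALG (\<lambda>\<eta>. 9 * \<alpha> \<eta>)"
  proof -
    obtain c where c: "achieves_ratio k \<L> M A c" "mono c" "c \<in> O(\<alpha>)"
      using rob unfolding robust_def by blast
    have "mono (\<lambda>\<eta>. 9 * c \<eta>)" using c(2) by (simp add: mono_def)
    moreover have "(\<lambda>\<eta>. 9 * c \<eta>) \<in> O(\<lambda>\<eta>. 9 * \<alpha> \<eta>)" using c(3) by simp
    ultimately show ?thesis
      using ratio[OF c(1)] unfolding robust_def by blast
  qed
  moreover have "competitive k M ALG (9 * \<gamma>)"
    using comp le(2) unfolding competitive_def by (force simp: mult.assoc)
  moreover have "caching_algorithm k M ALG"
    unfolding ALG_def using A B by (rule caching_algorithm_black_box)
  ultimately show "let ALG = (\<lambda>\<omega>. black_box (combine_lists k) (A \<omega>) (B \<omega>)) in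
         caching_algorithm k M ALG \<and>
         robust k \<L> M ALG (\<lambda>\<eta>. 9 * \<alpha> \<eta>) \<and>
         competitive k M ALG (9 * \<gamma>) \<and>
         (\<forall>c. achieves_ratio k \<L> M A c \<longrightarrow> achieves_ratio k \<L> M ALG (\<lambda>\<eta>. 9 * c \<eta>))"
    using ratio by (simp add: ALG_def Let_def)
qed

end
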